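(* Let $d\ge 2$, $m\ge 1$, and for all $i\in\{1,\dots,m\}$ let $\varphi_i:[0,1]^d\to[0,1]$ be such that $\ln\circ\varphi_i\circ\exp$ is homogeneous of degree $\lambda_i$. For $\theta=(\theta_1,\dots,\theta_m)^T\in\mathbb{R}^m$ write $$C(\cdot\mid\theta)=\prod_{i=1}^m\varphi_i^{\theta_i}(\cdot).$$ Let $K\ge 1$, let $p^{(1)},\dots,p^{(K)}\in(0,1)$ with $\sum_{k=1}^K p^{(k)}=1$, and for all $k\in\{1,\dots,K\}$ let $\theta_k=(\theta_{1k},\dots,\theta_{mk})^T\in\mathbb{R}^m$ be such that $C(\cdot\mid\theta_k)$ is a copula. Then the (Liebscher) copula $$\tilde C^{(K)}(u_1,\dots,u_d)=\prod_{k=1}^K C\big(u_1^{p^{(k)}},\dots,u_d^{p^{(k)}}\mid\theta_k\big),\qquad (u_1,\dots,u_d)\in[0,1]^d,$$ is given by $$\tilde C^{(K)}(\cdot)=C(\cdot\mid\tilde\theta_K),$$ where $\tilde\theta_K=(\tilde\theta_{1K},\dots,\tilde\theta_{mK})^T$ and, for all $i\in\{1,\dots,m\}$, $$\tilde\theta_{iK}=\sum_{k=1}^K\theta_{ik}\,(p^{(k)})^{\lambda_i}.$$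
   Context: The function $\ln\circ\varphi_i\circ\exp$ is defined on $\mathbb{R}_-^d=(-\infty,0]^d$, with $\exp$ applied componentwise (so $\varphi_i>0$ on $(0,1]^d$). A function $h$ on $\mathbb{R}_-^d$ is homogeneous of degree $\lambda\in\mathbb{R}$ if $h(tx)=t^\lambda h(x)$ for all $t>0$ and $x\in\mathbb{R}_-^d$. *)

theory Defs
  imports "HOL-Probability.Probability"
begin

definition vec_exp :: "real ^ 'd \<Rightarrow> real ^ 'd" where
  "vec_exp x = (\<chi> j. exp (x $ j))"

definition vec_powr :: "real ^ 'd \<Rightarrow> real \<Rightarrow> real ^ 'd" where
  "vec_powr u p = (\<chi> j. u $ j powr p)"

definition homogeneous_on_nonpos :: "(real ^ 'd \<Rightarrow> real) \<Rightarrow> real \<Rightarrow> bool" where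
  "homogeneous_on_nonpos h r \<longleftrightarrow>
     (\<forall>t>0. \<forall>x. (\<forall>j. x $ j \<le> 0) \<longrightarrow> h (t *\<^sub>R x) = t powr r * h x)"

(* The restriction to the unit cube (cbox 0 1) of the joint distribution function of a
   random vector with standard uniform margins. Values of C off the cube are irrelevant. *)
definition is_copula :: "(real ^ 'd \<Rightarrow> real) \<Rightarrow> bool" where
  "is_copula C \<longleftrightarrow>
     (\<exists>M :: (real ^ 'd) measure. prob_space M \<and> sets M = sets borel \<and>
        (\<forall>j. distr M borel (\<lambda>x. x $ j) = uniform_measure lborel {0..1}) \<and>
        (\<forall>u \<in> cbox 0 1. C u = measure M {x. \<forall>j. x $ j \<le> u $ j}))"

(* Since 0 powr a = 0 for every a, a vanishing factor makes the product vanish even when its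
   exponent is zero or negative. The factors of interest are positive on (0,1]^d, so this
   convention can only matter at points of the cube having a zero coordinate, where a copula
   has to be zero anyway. *)
definition power_family :: "nat \<Rightarrow> (nat \<Rightarrow> real ^ 'd \<Rightarrow> real) \<Rightarrow> (nat \<Rightarrow> real) \<Rightarrow> real ^ 'd \<Rightarrow> real" where
  "power_family m \<phi> \<theta> u = (\<Prod>i=1..m. \<phi> i u powr \<theta> i)"

definition liebscher :: "nat \<Rightarrow> (nat \<Rightarrow> real) \<Rightarrow> (nat \<Rightarrow> real ^ 'd \<Rightarrow> real) \<Rightarrow> real ^ 'd \<Rightarrow> real" where
  "liebscher K p C u = (\<Prod>k=1..K. C k (vec_powr u (p k)))"

end

theory Submission imports Defs begin

text \<open>
  Two independent facts make up the result.

  Liebscher's construction yields a copula. Let \<open>X\<^sub>1, \<dots>, X\<^sub>K\<close> be independent random vectors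
  distributed according to the given copulas. The vector with coordinates
  \<open>Y\<^sub>j = max\<^sub>k X\<^sub>k\<^sub>j powr (1 / p\<^sub>k)\<close> lies below \<open>u\<close> exactly when every \<open>X\<^sub>k\<close> lies below
  \<open>u powr p\<^sub>k\<close>, so its distribution function on the cube is the product of the copulas at these
  points. A single coordinate of \<open>Y\<close> has distribution function \<open>\<Prod>k. t powr p\<^sub>k = t\<close>, because the
  exponents add up to 1: the margins are again uniform (\<open>is_copula_liebscher\<close>).

  The closed form is homogeneity read on the multiplicative scale. Raising the argument to the power
  \<open>p\<close> scales its logarithm by \<open>p\<close>, so it scales \<open>ln (\<phi>\<^sub>i u)\<close> by \<open>p powr \<lambda>\<^sub>i\<close>, that is,
  \<open>\<phi>\<^sub>i (u powr p) = \<phi>\<^sub>i u powr (p powr \<lambda>\<^sub>i)\<close> (\<open>homogeneous_powr\<close>). Collecting the exponents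
  of each \<open>\<phi>\<^sub>i\<close> gives the new parameter at all points with positive coordinates. At a point with a
  vanishing coordinate every copula is zero. This kills the left-hand side; it also forces one of the
  \<open>\<phi>\<^sub>i\<close> to vanish there, which kills the right-hand side for whatever exponents it has.
\<close>

section \<open>Uniform margins\<close>

lemma measure_uniform_unit_interval_atMost:
  fixes t :: real
  assumes "0 \<le> t" "t \<le> 1"
  shows "measure (uniform_measure lborel {0..1}) {..t} = t"
proof -
  have "{0..1} \<inter> {..t} = {0..t}"
    using assms by auto
  then show ?thesis
    using assms by simp
qed

text \<open>
  By monotonicity, a distribution function with value 0 at 0 and value 1 at 1 is determined outside
  the unit interval.
\<close>

lemma uniform_measure_unit_intervalI:
  assumes M: "real_distribution M"
    and cdf: "\<And>t. 0 \<le> t \<Longrightarrow> t \<le> 1 \<Longrightarrow> cdf M t = t"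
  shows "M = uniform_measure lborel {0..1}"
proof (rule cdf_unique[OF M])
  let ?U = "uniform_measure lborel {0..1::real}"
  have "prob_space ?U"
    by (rule prob_space_uniform_measure) auto
  then show U: "real_distribution ?U"
    by (simp add: real_distribution_def real_distribution_axioms_def)
  have U_cdf: "cdf ?U t = t" if "0 \<le> t" "t \<le> 1" for t
    using that unfolding cdf_def by (rule measure_uniform_unit_interval_atMost)
  have clamp: "cdf D t = (if t < 0 then 0 else if t \<le> 1 then t else 1)"
    if "real_distribution D" and D: "\<And>t. 0 \<le> t \<Longrightarrow> t \<le> 1 \<Longrightarrow> cdf D t = t" for D t
  proof -
    interpret real_distribution D by fact
    have "cdf D t \<le> 0" if "t < 0"
      using cdf_nondecreasing[of t 0] D[of 0] that by simp
    moreover have "1 \<le> cdf D t" if "1 < t"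
      using cdf_nondecreasing[of 1 t] D[of 1] that by simp
    ultimately show ?thesis
      using D[of t] cdf_nonneg[of t] cdf_bounded_prob[of t]
      by (cases "t < 0"; cases "t \<le> 1") auto
  qed
  show "cdf M = cdf ?U"
    using clamp[OF M cdf] clamp[OF U U_cdf] by auto
qed

lemma measure_uniform_margin:
  fixes M :: "(real ^ 'd) measure"
  assumes [measurable_cong]: "sets M = sets borel"
    and margin: "distr M borel (\<lambda>x. x $ j) = uniform_measure lborel {0..1}"
    and "0 \<le> t" "t \<le> 1"
  shows "measure M {x. x $ j \<le> t} = t"
proof -
  have "space M = UNIV"
    using sets_eq_imp_space_eq[OF assms(1)] by simp
  then have "measure M {x. x $ j \<le> t} = measure (distr M borel (\<lambda>x. x $ j)) {..t}"
    by (subst measure_distr) (auto simp: vimage_def)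
  then show ?thesis
    using assms by (simp only: margin measure_uniform_unit_interval_atMost)
qed

text \<open>A joint distribution function is bounded by each of its margins.\<close>

lemma copula_eq_0:
  fixes C :: "real ^ 'd \<Rightarrow> real"
  assumes C: "is_copula C" and u: "u \<in> cbox 0 1" and "u $ j = 0"
  shows "C u = 0"
proof -
  obtain M :: "(real ^ 'd) measure" where M: "prob_space M" "sets M = sets borel"
    "distr M borel (\<lambda>x. x $ j) = uniform_measure lborel {0..1}"
    and Cu: "C u = measure M {x. \<forall>i. x $ i \<le> u $ i}"
    using C u unfolding is_copula_def by blast
  interpret prob_space M by fact
  have "{x. x $ j \<le> 0} \<in> sets M"
    unfolding M(2) by measurable
  then have "measure M {x. \<forall>i. x $ i \<le> u $ i} \<le> measure M {x. x $ j \<le> 0}"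
    using \<open>u $ j = 0\<close> by (intro finite_measure_mono) (auto dest: spec[of _ j])
  also have "\<dots> = 0"
    using M by (intro measure_uniform_margin) auto
  finally show ?thesis
    using Cu measure_nonneg[of M "{x. \<forall>i. x $ i \<le> u $ i}"] by simp
qed

section \<open>Liebscher's construction\<close>

lemma vec_powr_in_unit_cube:
  fixes u :: "real ^ 'd"
  assumes "u \<in> cbox 0 1" "0 \<le> p"
  shows "vec_powr u p \<in> cbox 0 1"
  using assms by (auto simp: vec_powr_def mem_box_cart intro: powr_le1)

text \<open>
  Truncating at 0 makes the equivalence hold for negative \<open>x\<close> as well, where the real power has no
  useful meaning.
\<close>

lemma max_0_powr_inverse_le_iff:
  fixes x t p :: real
  assumes "0 < p" "0 \<le> t"
  shows "max 0 x powr (1 / p) \<le> t \<longleftrightarrow> x \<le> t powr p"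
proof (cases "0 < x")
  case True
  have "x powr (1 / p) \<le> t \<longleftrightarrow> (x powr (1 / p)) powr p \<le> t powr p"
    using assms powr_mono2[of p "x powr (1 / p)" t] powr_less_mono2[of p t "x powr (1 / p)"]
    by (cases "x powr (1 / p) \<le> t") auto
  then show ?thesis
    using True assms by (simp add: powr_powr)
next
  case False
  then have "max 0 x = 0"
    by simp
  then show ?thesis
    using False assms by (simp add: order_trans[of x 0])
qed

text \<open>
  The joint distribution of the componentwise maxima, for an arbitrary set \<open>J\<close> of coordinates:
  all coordinates give the distribution function, a single one gives a margin.
\<close>

lemma measure_liebscher_maxima:
  fixes M :: "nat \<Rightarrow> (real ^ 'd) measure" and p :: "nat \<Rightarrow> real" and K :: nat
  defines "Y \<equiv> \<lambda>\<omega>. \<chi> j. Max ((\<lambda>k. max 0 (\<omega> k $ j) powr (1 / p k)) ` {1..K})"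
  assumes M: "\<And>k. prob_space (M k)" and sets_M: "\<And>k. sets (M k) = sets borel"
    and "1 \<le> K" and p: "\<And>k. k \<in> {1..K} \<Longrightarrow> 0 < p k"
  shows measurable_liebscher_maxima: "Y \<in> borel_measurable (PiM {1..K} M)"
    and "u \<in> cbox 0 1 \<Longrightarrow>
      measure (distr (PiM {1..K} M) borel Y) {x. \<forall>j\<in>J. x $ j \<le> u $ j} =
        (\<Prod>k=1..K. measure (M k) {x. \<forall>j\<in>J. x $ j \<le> vec_powr u (p k) $ j})"
proof -
  let ?P = "PiM {1..K} M"
  note sets_M[measurable_cong]
  have product: "product_prob_space M"
    using M by (rule product_prob_spaceI)
  interpret finite_product_prob_space M "{1..K}"
    using product by (simp add: finite_product_prob_space_def product_prob_space_def
        finite_product_sigma_finite_def finite_product_sigma_finite_axioms_def)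
  have space_M: "space (M k) = UNIV" for k
    using sets_eq_imp_space_eq[OF sets_M[of k]] by simp
  have "(\<lambda>\<omega>. \<omega> k $ j) \<in> borel_measurable ?P" if "k \<in> {1..K}" for j k
    using measurable_component_singleton[OF that, of M]
    by (rule measurable_compose) measurable
  then have "(\<lambda>\<omega>. max 0 (\<omega> k $ j) powr (1 / p k)) \<in> borel_measurable ?P"
    if "k \<in> {1..K}" for j k
    using that by measurable
  then have "(\<lambda>\<omega>. Y \<omega> $ j) \<in> borel_measurable ?P" for j
    unfolding Y_def vec_lambda_beta by (intro borel_measurable_Max) auto
  then show Y: "Y \<in> borel_measurable ?P"
    by (subst borel_measurable_euclidean_space) (auto simp: Basis_vec_def inner_axis)
  show "measure (distr ?P borel Y) {x. \<forall>j\<in>J. x $ j \<le> u $ j} =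
      (\<Prod>k=1..K. measure (M k) {x. \<forall>j\<in>J. x $ j \<le> vec_powr u (p k) $ j})"
    if u: "u \<in> cbox 0 1"
  proof -
    let ?A = "\<lambda>v :: real ^ 'd. {x :: real ^ 'd. \<forall>j\<in>J. x $ j \<le> v $ j}"
    have A[measurable]: "?A v \<in> sets borel" for v
      by measurable
    have Y_le: "Y \<omega> $ j \<le> u $ j \<longleftrightarrow> (\<forall>k\<in>{1..K}. \<omega> k $ j \<le> vec_powr u (p k) $ j)" for \<omega> j
      using u p \<open>1 \<le> K\<close>
      by (auto simp: Y_def vec_powr_def mem_box_cart max_0_powr_inverse_le_iff)
    have "Y -` ?A u \<inter> space ?P = (\<Pi>\<^sub>E k\<in>{1..K}. ?A (vec_powr u (p k)))"
      by (auto simp: Y_le space_PiM space_M PiE_iff)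
    then have "measure (distr ?P borel Y) (?A u) = measure ?P (\<Pi>\<^sub>E k\<in>{1..K}. ?A (vec_powr u (p k)))"
      using Y A by (simp add: measure_distr)
    also have "\<dots> = (\<Prod>k=1..K. measure (M k) (?A (vec_powr u (p k))))"
      by (rule finite_measure_PiM_emb) (simp add: sets_M)
    finally show ?thesis .
  qed
qed

lemma is_copula_liebscher:
  fixes C :: "nat \<Rightarrow> real ^ 'd \<Rightarrow> real"
  assumes "1 \<le> K" and p: "\<And>k. k \<in> {1..K} \<Longrightarrow> 0 < p k" and p_sum: "(\<Sum>k=1..K. p k) = 1"
    and C: "\<And>k. k \<in> {1..K} \<Longrightarrow> is_copula (C k)"
  shows "is_copula (liebscher K p C)"
proof -
  let ?good = "\<lambda>k M. prob_space M \<and> sets M = sets borel \<and>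
    (\<forall>j. distr M borel (\<lambda>x. x $ j) = uniform_measure lborel {0..1}) \<and>
    (\<forall>u \<in> cbox 0 1. C k u = measure M {x :: real ^ 'd. \<forall>j. x $ j \<le> u $ j})"
  have "\<forall>k\<in>{1..K}. \<exists>M. ?good k M"
    using C unfolding is_copula_def by blast
  from bchoice[OF this] obtain M0 where M0: "\<And>k. k \<in> {1..K} \<Longrightarrow> ?good k (M0 k)"
    by blast
  (* Product measures are taken over total families: outside {1..K} any probability measure on the
     Borel sets serves, for instance the first one. *)
  define M where "M k = M0 (if k \<in> {1..K} then k else 1)" for k
  have M: "prob_space (M k)" "sets (M k) = sets borel"
    "distr (M k) borel (\<lambda>x. x $ j) = uniform_measure lborel {0..1}" for k j
    using M0[of "if k \<in> {1..K} then k else 1"] \<open>1 \<le> K\<close> by (auto simp: M_def)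
  have C_eq: "C k u = measure (M k) {x. \<forall>j. x $ j \<le> u $ j}"
    if "k \<in> {1..K}" "u \<in> cbox 0 1" for k u
    using M0[OF that(1)] that by (simp add: M_def)
  let ?P = "PiM {1..K} M"
  let ?Y = "\<lambda>\<omega>. \<chi> j. Max ((\<lambda>k. max 0 (\<omega> k $ j :: real) powr (1 / p k)) ` {1..K})"
  define N where "N = distr ?P borel ?Y"
  have Y: "?Y \<in> borel_measurable ?P"
    using M(1,2) \<open>1 \<le> K\<close> p by (rule measurable_liebscher_maxima)
  have N_eq: "measure N {x. \<forall>j\<in>J. x $ j \<le> u $ j} =
      (\<Prod>k=1..K. measure (M k) {x. \<forall>j\<in>J. x $ j \<le> vec_powr u (p k) $ j})"
    if "u \<in> cbox 0 1" for u J
    unfolding N_def using M(1,2) \<open>1 \<le> K\<close> p that by (rule measure_liebscher_maxima)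
  interpret N: prob_space N
    unfolding N_def using Y M(1) by (intro prob_space.prob_space_distr prob_space_PiM)
  have sets_N[measurable_cong]: "sets N = sets borel" and space_N: "space N = UNIV"
    by (simp_all add: N_def)
  have "distr N borel (\<lambda>x. x $ j) = uniform_measure lborel {0..1}" for j
  proof (rule uniform_measure_unit_intervalI)
    have "prob_space (distr N borel (\<lambda>x. x $ j))"
      by (rule N.prob_space_distr) measurable
    then show "real_distribution (distr N borel (\<lambda>x. x $ j))"
      by (simp add: real_distribution_def real_distribution_axioms_def)
    fix t :: real
    assume t: "0 \<le> t" "t \<le> 1"
    define u :: "real ^ 'd" where "u = (\<chi> i. t)"
    have u: "u \<in> cbox 0 1"
      using t by (simp add: u_def mem_box_cart)
    have "cdf (distr N borel (\<lambda>x. x $ j)) t = measure N {x. x $ j \<le> t}"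
      unfolding cdf_def by (subst measure_distr) (auto simp: space_N vimage_def)
    also have "\<dots> = (\<Prod>k=1..K. measure (M k) {x. x $ j \<le> t powr p k})"
      using N_eq[OF u, of "{j}"] by (simp add: u_def vec_powr_def)
    also have "\<dots> = (\<Prod>k=1..K. t powr p k)"
      using t p M
      by (intro prod.cong refl measure_uniform_margin) (auto intro!: powr_le1 less_imp_le[OF p])
    also have "\<dots> = t"
    proof (cases "t = 0")
      case True
      then show ?thesis
        using \<open>1 \<le> K\<close> by auto
    next
      case False
      then have "(\<Prod>k=1..K. t powr p k) = t powr (\<Sum>k=1..K. p k)"
        by (simp add: powr_sum)
      then show ?thesis
        using t p_sum by simp
    qed
    finally show "cdf (distr N borel (\<lambda>x. x $ j)) t = t" .
  qed
  moreover have "liebscher K p C u = measure N {x. \<forall>j. x $ j \<le> u $ j}"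
    if u: "u \<in> cbox 0 1" for u
  proof -
    have "liebscher K p C u =
        (\<Prod>k=1..K. measure (M k) {x. \<forall>j. x $ j \<le> vec_powr u (p k) $ j})"
      unfolding liebscher_def using u p
      by (intro prod.cong refl C_eq vec_powr_in_unit_cube) (auto intro: less_imp_le)
    then show ?thesis
      using N_eq[OF u, of UNIV] by simp
  qed
  ultimately show ?thesis
    unfolding is_copula_def using N.prob_space_axioms sets_N by blast
qed

section \<open>Homogeneous factors\<close>

lemma homogeneous_powr:
  fixes f :: "real ^ 'd \<Rightarrow> real"
  assumes hom: "homogeneous_on_nonpos (ln \<circ> f \<circ> vec_exp) r"
    and pos: "\<And>u. (\<forall>j. 0 < u $ j \<and> u $ j \<le> 1) \<Longrightarrow> 0 < f u"
    and u: "\<forall>j. 0 < u $ j \<and> u $ j \<le> 1" and "0 < p"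
  shows "f (vec_powr u p) = f u powr (p powr r)"
proof -
  define x where "x = (\<chi> j. ln (u $ j))"
  have x: "vec_exp x = u" "vec_exp (p *\<^sub>R x) = vec_powr u p" "\<forall>j. x $ j \<le> 0"
    using u by (auto simp: x_def vec_exp_def vec_powr_def vec_eq_iff powr_def less_imp_neq[THEN not_sym])
  have "\<forall>j. 0 < vec_powr u p $ j \<and> vec_powr u p $ j \<le> 1"
    using u \<open>0 < p\<close> by (simp add: vec_powr_def less_imp_le powr_le1 less_imp_neq[THEN not_sym])
  then have "0 < f (vec_powr u p)"
    by (rule pos)
  moreover have "ln (f (vec_powr u p)) = p powr r * ln (f u)"
    using hom[unfolded homogeneous_on_nonpos_def, rule_format, OF \<open>0 < p\<close>, of x] x by simp
  ultimately show ?thesis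
    using pos[OF u] exp_ln[of "f (vec_powr u p)"] by (simp add: powr_def)
qed

lemma liebscher_power_family_eq:
  fixes \<phi> :: "nat \<Rightarrow> real ^ 'd \<Rightarrow> real"
  assumes pos: "\<And>i. i \<in> {1..m} \<Longrightarrow> 0 < \<phi> i u"
    and scale: "\<And>i k. i \<in> {1..m} \<Longrightarrow> k \<in> {1..K} \<Longrightarrow>
      \<phi> i (vec_powr u (p k)) = \<phi> i u powr (p k powr lam i)"
  shows "liebscher K p (\<lambda>k. power_family m \<phi> (\<lambda>i. \<theta> i k)) u =
    power_family m \<phi> (\<lambda>i. \<Sum>k=1..K. \<theta> i k * p k powr lam i) u"
proof -
  have "liebscher K p (\<lambda>k. power_family m \<phi> (\<lambda>i. \<theta> i k)) u =
      (\<Prod>k=1..K. \<Prod>i=1..m. \<phi> i u powr (\<theta> i k * p k powr lam i))"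
    unfolding liebscher_def power_family_def
    by (intro prod.cong refl) (simp add: scale powr_powr mult.commute)
  also have "\<dots> = (\<Prod>i=1..m. \<Prod>k=1..K. \<phi> i u powr (\<theta> i k * p k powr lam i))"
    by (rule prod.swap)
  also have "\<dots> = power_family m \<phi> (\<lambda>i. \<Sum>k=1..K. \<theta> i k * p k powr lam i) u"
    unfolding power_family_def
  proof (intro prod.cong refl)
    fix i
    assume "i \<in> {1..m}"
    then have "\<phi> i u \<noteq> 0"
      using pos by fastforce
    then show "(\<Prod>k=1..K. \<phi> i u powr (\<theta> i k * p k powr lam i)) =
        \<phi> i u powr (\<Sum>k=1..K. \<theta> i k * p k powr lam i)"
      by (simp add: powr_sum)
  qed
  finally show ?thesis .
qed

section \<open>Closure of the power family\<close>

theorem proposition3: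
  fixes \<phi> :: "nat \<Rightarrow> real ^ 'd \<Rightarrow> real"
    and lam p :: "nat \<Rightarrow> real"
    and \<theta> :: "nat \<Rightarrow> nat \<Rightarrow> real"
    and m K :: nat
  assumes "CARD('d) \<ge> 2" and "m \<ge> 1"
    and "\<And>i u. i \<in> {1..m} \<Longrightarrow> u \<in> cbox 0 1 \<Longrightarrow> \<phi> i u \<in> {0..1}"
    and "\<And>i u. i \<in> {1..m} \<Longrightarrow> (\<forall>j. 0 < u $ j \<and> u $ j \<le> 1) \<Longrightarrow> \<phi> i u > 0"
    and "\<And>i. i \<in> {1..m} \<Longrightarrow> homogeneous_on_nonpos (ln \<circ> \<phi> i \<circ> vec_exp) (lam i)"
    and "K \<ge> 1"
    and "\<And>k. k \<in> {1..K} \<Longrightarrow> p k \<in> {0<..<1}"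
    and "(\<Sum>k=1..K. p k) = 1"
    and "\<And>k. k \<in> {1..K} \<Longrightarrow> is_copula (power_family m \<phi> (\<lambda>i. \<theta> i k))"
  shows "is_copula (liebscher K p (\<lambda>k. power_family m \<phi> (\<lambda>i. \<theta> i k))) \<and>
    (\<forall>u \<in> cbox 0 1. liebscher K p (\<lambda>k. power_family m \<phi> (\<lambda>i. \<theta> i k)) u =
       power_family m \<phi> (\<lambda>i. \<Sum>k=1..K. \<theta> i k * p k powr lam i) u)"
proof
  let ?C = "\<lambda>k. power_family m \<phi> (\<lambda>i. \<theta> i k)"
  let ?\<theta> = "\<lambda>i. \<Sum>k=1..K. \<theta> i k * p k powr lam i"
  have p: "0 < p k" if "k \<in> {1..K}" for k
    using assms(7)[OF that] by simp
  show "is_copula (liebscher K p ?C)"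
    using assms(6,8,9) p by (intro is_copula_liebscher)
  show "\<forall>u \<in> cbox 0 1. liebscher K p ?C u = power_family m \<phi> ?\<theta> u"
  proof
    fix u :: "real ^ 'd"
    assume u: "u \<in> cbox 0 1"
    show "liebscher K p ?C u = power_family m \<phi> ?\<theta> u"
    proof (cases "\<exists>j. u $ j = 0")
      case True
      then obtain j where j: "u $ j = 0" ..
      have K: "1 \<in> {1..K}"
        using assms(6) by simp
      have "?C 1 (vec_powr u (p 1)) = 0"
        using assms(9)[OF K] p[OF K] u j
        by (intro copula_eq_0 vec_powr_in_unit_cube) (auto simp: vec_powr_def)
      then have "liebscher K p ?C u = 0"
        unfolding liebscher_def using K by (intro prod_zero) auto
      (* A real power vanishes only if its base does, whatever the exponent. *)
      moreover have "?C 1 u = 0"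
        using assms(9)[OF K] u j by (rule copula_eq_0)
      then have "power_family m \<phi> ?\<theta> u = 0"
        by (auto simp: power_family_def)
      ultimately show ?thesis
        by simp
    next
      case False
      then have u': "\<forall>j. 0 < u $ j \<and> u $ j \<le> 1"
        using u by (auto simp: mem_box_cart less_le)
      show ?thesis
        using assms(4,5) u' p by (intro liebscher_power_family_eq homogeneous_powr) auto
    qed
  qed
qed

end
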